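(* Let $G$ be a finitely generated, residually finite group and let $(M_k)_{k>0}$ be a filtration of $G$. The following are equivalent: (i) the box space $\square_{(M_k)}G$ satisfies property $D_1$; (ii) $G$ is virtually cyclic.
   Context: A filtration of a finitely generated residually finite group $G$ is a decreasing sequence $(M_k)_{k>0}$ of finite index normal subgroups of $G$ with trivial intersection. Fix a finite generating set $S$ of $G$ and view each $G/M_k$ as a Cayley graph (with its word metric) with respect to $S$. The box space $\square_{(M_k)}G$ is the coarse disjoint union of the components $G/M_k$, i.e. their disjoint union with a metric inducing the word metric on each component and with the distance between two different components at least the maximum of their diameters. For $\alpha\in(0,1]$, $\square_{(M_k)}G$ has property $D_\alpha$ if there exists $K>0$ (only depending on $S$) such that $\mathrm{diam}(G/M)\ge K\,|G/M|^\alpha$ for every component $G/M$ of $\square_{(M_k)}G$.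
   Formalization: The formal theorem also assumes that every M_k is a proper subgroup of G, since a one-point component has diameter 0 and makes D_1 fail (for example G = Z with M_1 = Z), although G may be virtually cyclic. *)

theory Defs
  imports "HOL-Analysis.Analysis" "HOL-Algebra.Algebra"
begin

definition finite_index :: "('a, 'b) monoid_scheme \<Rightarrow> 'a set \<Rightarrow> bool" where
  "finite_index G H \<longleftrightarrow> finite (rcosets\<^bsub>G\<^esub> H)"

definition residually_finite :: "('a, 'b) monoid_scheme \<Rightarrow> bool" where
  "residually_finite G \<longleftrightarrow>
     (\<forall>g \<in> carrier G - {\<one>\<^bsub>G\<^esub>}. \<exists>N. N \<lhd> G \<and> finite_index G N \<and> g \<notin> N)"

definition virtually_cyclic :: "('a, 'b) monoid_scheme \<Rightarrow> bool" where
  "virtually_cyclic G \<longleftrightarrow>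
     (\<exists>H. subgroup H G \<and> finite_index G H \<and> cyclic_group (subgroup_generated G H))"

definition finite_generating_set :: "('a, 'b) monoid_scheme \<Rightarrow> 'a set \<Rightarrow> bool" where
  "finite_generating_set G S \<longleftrightarrow>
     finite S \<and> S \<subseteq> carrier G \<and> generate G S = carrier G"

text \<open>The sequence is indexed from 0 rather than from 1, and need not be strictly decreasing.\<close>

definition filtration :: "('a, 'b) monoid_scheme \<Rightarrow> (nat \<Rightarrow> 'a set) \<Rightarrow> bool" where
  "filtration G M \<longleftrightarrow>
     (\<forall>k. M k \<lhd> G \<and> finite_index G (M k)) \<and> decseq M \<and> (\<Inter>k. M k) = {\<one>\<^bsub>G\<^esub>}"

text \<open>The word metric is the path metric of the Cayley graph whose edges join \<open>x\<close> to \<open>x \<otimes> s\<close>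
  for \<open>s \<in> S\<close>, edges being traversed in either direction; hence words in \<open>S\<close> and its inverses.\<close>

definition word_length :: "('a, 'b) monoid_scheme \<Rightarrow> 'a set \<Rightarrow> 'a \<Rightarrow> nat" where
  "word_length G S g =
     (LEAST n. \<exists>ws. length ws = n \<and> set ws \<subseteq> S \<union> m_inv G ` S \<and>
        foldr (\<otimes>\<^bsub>G\<^esub>) ws \<one>\<^bsub>G\<^esub> = g)"

definition word_metric :: "('a, 'b) monoid_scheme \<Rightarrow> 'a set \<Rightarrow> 'a \<Rightarrow> 'a \<Rightarrow> nat" where
  "word_metric G S x y = word_length G S (inv\<^bsub>G\<^esub> x \<otimes>\<^bsub>G\<^esub> y)"

text \<open>Points of the box space are cosets tagged with their index, so that the components
  are disjoint (also when some \<open>M k\<close> coincide).\<close>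

definition box_component ::
    "('a, 'b) monoid_scheme \<Rightarrow> (nat \<Rightarrow> 'a set) \<Rightarrow> nat \<Rightarrow> (nat \<times> 'a set) set" where
  "box_component G M k = {k} \<times> carrier (G Mod M k)"

definition box_points ::
    "('a, 'b) monoid_scheme \<Rightarrow> (nat \<Rightarrow> 'a set) \<Rightarrow> (nat \<times> 'a set) set" where
  "box_points G M = (\<Union>k. box_component G M k)"

definition diam :: "('p \<Rightarrow> 'p \<Rightarrow> real) \<Rightarrow> 'p set \<Rightarrow> real" where
  "diam d A = (SUP (x, y) \<in> A \<times> A. d x y)"

text \<open>The coarse disjoint union does not determine its metric uniquely: \<open>box_space_metric G S M d\<close>
  says that \<open>d\<close> is one of the metrics turning the disjoint union into a box space.
  The generating set of \<open>G Mod M k\<close> is the image of \<open>S\<close>.\<close>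

definition box_space_metric ::
    "('a, 'b) monoid_scheme \<Rightarrow> 'a set \<Rightarrow> (nat \<Rightarrow> 'a set) \<Rightarrow>
     (nat \<times> 'a set \<Rightarrow> nat \<times> 'a set \<Rightarrow> real) \<Rightarrow> bool" where
  "box_space_metric G S M d \<longleftrightarrow>
     Metric_space (box_points G M) d \<and>
     (\<forall>k. \<forall>x \<in> carrier (G Mod M k). \<forall>y \<in> carrier (G Mod M k).
        d (k, x) (k, y) = real (word_metric (G Mod M k) ((\<lambda>s. M k #>\<^bsub>G\<^esub> s) ` S) x y)) \<and>
     (\<forall>k l. k \<noteq> l \<longrightarrow> (\<forall>p \<in> box_component G M k. \<forall>q \<in> box_component G M l.
        d p q \<ge> max (diam d (box_component G M k)) (diam d (box_component G M l))))"

text \<open>A component with a single point has diameter 0 and cardinality 1, so the inequality fails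
  for it, whatever \<open>K\<close> is: \<open>property_D\<close> forces every \<open>M k\<close> to be a proper subgroup.\<close>

definition property_D ::
    "('a, 'b) monoid_scheme \<Rightarrow> (nat \<Rightarrow> 'a set) \<Rightarrow>
     (nat \<times> 'a set \<Rightarrow> nat \<times> 'a set \<Rightarrow> real) \<Rightarrow> real \<Rightarrow> bool" where
  "property_D G M d \<alpha> \<longleftrightarrow>
     (\<exists>K>0. \<forall>k. diam d (box_component G M k) \<ge> K * real (card (box_component G M k)) powr \<alpha>)"

end

theory Submission
  imports Defs
begin

text \<open>Property \<open>D\<^sub>1\<close> is equivalent to linear growth of \<open>G\<close>, and so is virtual cyclicity.

  Let \<open>Q = G / M\<^sub>k\<close> have diameter \<open>D\<close>. Balls of radius \<open>r\<close> centred at points spaced \<open>2 r + 1\<close>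
  apart on a geodesic of length \<open>D\<close> are disjoint, so a ball of radius \<open>r\<close> has at most about
  \<open>(2 r + 1) |Q| / D\<close> elements; under \<open>D\<^sub>1\<close> this is at most \<open>(2 r + 1) / K\<close>, and for \<open>k\<close> large
  the ball of radius \<open>r\<close> in \<open>G\<close> embeds in \<open>Q\<close>. Conversely \<open>Q\<close> is the image of the ball of
  radius \<open>D\<close> in \<open>G\<close>, so linear growth bounds \<open>|Q|\<close> linearly in \<open>D\<close>.

  An infinite group of linear growth has an element of infinite order: the shortlex-minimal words
  form a factor-closed language, hence there is an infinite word all of whose factors are minimal.
  Linear growth forces its factor complexity to stop growing somewhere, so by the Morse--Hedlund
  argument it is eventually periodic, and the period evaluates to an element all of whose powers
  are nontrivial. If such an element generated a subgroup of infinite index, its powers times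
  representatives of distinct cosets would give quadratic growth.\<close>

text \<open>The alphabet is a parameter, so that balls in \<open>G\<close> and balls in its
  quotients over the image alphabet are instances of the same constant.\<close>

definition word_ball :: "('a, 'b) monoid_scheme \<Rightarrow> 'a set \<Rightarrow> nat \<Rightarrow> 'a set" where
  "word_ball G A n = (\<lambda>ws. foldr (\<otimes>\<^bsub>G\<^esub>) ws \<one>\<^bsub>G\<^esub>) ` {ws. set ws \<subseteq> A \<and> length ws \<le> n}"

section \<open>Evaluation of words in a group\<close>

context group
begin

lemma foldr_mult_closed [simp]:
  "set ws \<subseteq> carrier G \<Longrightarrow> foldr (\<otimes>) ws \<one> \<in> carrier G"
  by (induction ws) auto

lemma foldr_mult_append:
  assumes "set us \<subseteq> carrier G" "set vs \<subseteq> carrier G"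
  shows "foldr (\<otimes>) (us @ vs) \<one> = foldr (\<otimes>) us \<one> \<otimes> foldr (\<otimes>) vs \<one>"
  using assms by (induction us) (auto simp: m_assoc simp del: foldr_append)

lemma foldr_mult_rev_inv:
  assumes "set ws \<subseteq> carrier G"
  shows "foldr (\<otimes>) (rev (map (m_inv G) ws)) \<one> = inv (foldr (\<otimes>) ws \<one>)"
  using assms
proof (induction ws)
  case (Cons w ws)
  have "m_inv G ` set ws \<subseteq> carrier G"
    using Cons.prems by auto
  then show ?case
    using Cons foldr_mult_append[of "rev (map (m_inv G) ws)" "[inv w]"]
    by (simp add: inv_mult_group del: foldr_append)
qed simp

lemma foldr_mult_concat_replicate:
  assumes "set ws \<subseteq> carrier G"
  shows "foldr (\<otimes>) (concat (replicate n ws)) \<one> = foldr (\<otimes>) ws \<one> [^] n"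
proof (induction n)
  case (Suc n)
  have "set (concat (replicate n ws)) \<subseteq> carrier G"
    using assms by (auto split: if_splits)
  then show ?case
    using Suc assms foldr_mult_append[OF assms, of "concat (replicate n ws)"]
      nat_pow_Suc2[of "foldr (\<otimes>) ws \<one>" n] foldr_mult_closed[OF assms]
    by (metis concat.simps(2) replicate_Suc)
qed simp

end

section \<open>Word length and balls\<close>

locale finitely_generated_group = group G for G (structure) +
  fixes S :: "'a set"
  assumes generating: "finite_generating_set G S"
begin

abbreviation letters :: "'a set" where
  "letters \<equiv> S \<union> m_inv G ` S"

abbreviation ball :: "nat \<Rightarrow> 'a set" where
  "ball \<equiv> word_ball G letters"

abbreviation len :: "'a \<Rightarrow> nat" where
  "len \<equiv> word_length G S"

lemma S_closed: "S \<subseteq> carrier G" and finite_S: "finite S" and generate_S: "generate G S = carrier G"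
  using generating by (auto simp: finite_generating_set_def)

lemma letters_closed: "letters \<subseteq> carrier G"
  using S_closed by auto

lemma finite_letters: "finite letters"
  using finite_S by simp

lemma inv_letters: "a \<in> letters \<Longrightarrow> inv a \<in> letters"
  using S_closed by auto

lemma word_closed [simp]: "set ws \<subseteq> letters \<Longrightarrow> foldr (\<otimes>) ws \<one> \<in> carrier G"
  by (rule foldr_mult_closed) (use letters_closed in blast)

lemma word_append:
  "set us \<subseteq> letters \<Longrightarrow> set vs \<subseteq> letters \<Longrightarrow>
    foldr (\<otimes>) (us @ vs) \<one> = foldr (\<otimes>) us \<one> \<otimes> foldr (\<otimes>) vs \<one>"
  by (rule foldr_mult_append) (use letters_closed in blast)+

lemma mem_ballI: "set ws \<subseteq> letters \<Longrightarrow> length ws \<le> n \<Longrightarrow> foldr (\<otimes>) ws \<one> \<in> ball n"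
  by (auto simp: word_ball_def)

lemma mem_ballE:
  assumes "x \<in> ball n"
  obtains ws where "set ws \<subseteq> letters" "length ws \<le> n" "x = foldr (\<otimes>) ws \<one>"
  using assms by (auto simp: word_ball_def)

lemma ball_closed: "ball n \<subseteq> carrier G"
  using word_closed by (auto simp: word_ball_def)

lemma ball_mono: "m \<le> n \<Longrightarrow> ball m \<subseteq> ball n"
  by (auto simp: word_ball_def)

lemma finite_ball: "finite (ball n)"
  unfolding word_ball_def using finite_lists_length_le[OF finite_letters] by simp

lemma one_in_ball: "\<one> \<in> ball n"
  using mem_ballI[of "[]"] by simp

lemma letter_in_ball: "a \<in> letters \<Longrightarrow> a \<in> ball 1"
  using mem_ballI[of "[a]"] letters_closed by auto

lemma ball_mult: "x \<in> ball m \<Longrightarrow> y \<in> ball n \<Longrightarrow> x \<otimes> y \<in> ball (m + n)"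
  by (elim mem_ballE) (use word_append mem_ballI[of "_ @ _" "m + n"] in \<open>fastforce simp del: foldr_append\<close>)

lemma ball_inv:
  assumes "x \<in> ball n"
  shows "inv x \<in> ball n"
proof -
  obtain ws where ws: "set ws \<subseteq> letters" "length ws \<le> n" "x = foldr (\<otimes>) ws \<one>"
    using assms by (rule mem_ballE)
  have "set (rev (map (m_inv G) ws)) \<subseteq> letters"
    using ws(1) inv_letters by auto
  moreover have "set ws \<subseteq> carrier G"
    using ws(1) letters_closed by blast
  ultimately show ?thesis
    using ws mem_ballI[of "rev (map (m_inv G) ws)" n] by (simp add: foldr_mult_rev_inv)
qed

lemma ball_pow: "x \<in> ball n \<Longrightarrow> x [^] (k::nat) \<in> ball (k * n)"
  by (induction k) (use one_in_ball ball_mult[of "x [^] _" _ x n] in \<open>auto simp: add.commute[of n]\<close>)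

lemma ex_ball:
  assumes "x \<in> carrier G"
  shows "\<exists>n. x \<in> ball n"
proof -
  have "x \<in> generate G S"
    using assms generate_S by simp
  then show ?thesis
  proof induction
    case one
    then show ?case using one_in_ball by blast
  next
    case (incl h)
    then show ?case using letter_in_ball by blast
  next
    case (inv h)
    then show ?case using letter_in_ball by blast
  next
    case (eng h1 h2)
    then show ?case using ball_mult by blast
  qed
qed

text \<open>Since \<open>S\<close> generates \<open>G\<close>, some word represents
  \<open>x\<close>, so the \<open>LEAST\<close> in \<open>word_length\<close> is attained.\<close>

lemma len_word:
  assumes "x \<in> carrier G"
  obtains ws where "set ws \<subseteq> letters" "length ws = len x" "foldr (\<otimes>) ws \<one> = x"
proof -
  from ex_ball[OF assms] have "\<exists>n ws. length ws = n \<and> set ws \<subseteq> letters \<and> foldr (\<otimes>) ws \<one> = x"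
    by (auto elim: mem_ballE)
  from LeastI_ex[OF this] show ?thesis
    using that by (auto simp: word_length_def)
qed

lemma len_le_iff:
  assumes "x \<in> carrier G"
  shows "len x \<le> n \<longleftrightarrow> x \<in> ball n"
proof
  assume "len x \<le> n"
  then show "x \<in> ball n"
    using len_word[OF assms] mem_ballI by metis
next
  assume "x \<in> ball n"
  then obtain ws where "set ws \<subseteq> letters" "length ws \<le> n" "x = foldr (\<otimes>) ws \<one>"
    by (rule mem_ballE)
  then show "len x \<le> n"
    unfolding word_length_def by (intro Least_le[THEN order_trans]) auto
qed

lemma len_mult:
  "x \<in> carrier G \<Longrightarrow> y \<in> carrier G \<Longrightarrow> len (x \<otimes> y) \<le> len x + len y"
  by (metis ball_mult len_le_iff m_closed order_refl)

lemma len_inv: "x \<in> carrier G \<Longrightarrow> len (inv x) \<le> len x"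
  by (meson ball_inv inv_closed len_le_iff order_refl)

text \<open>A prefix of a shortest word is itself shortest: a shorter word for the prefix, followed
  by the remaining \<open>len x - j\<close> letters, would represent \<open>x\<close> with fewer
  than \<open>len x\<close> letters.\<close>

lemma ex_len_eq:
  assumes "x \<in> carrier G" "j \<le> len x"
  shows "\<exists>y\<in>carrier G. len y = j"
proof -
  obtain ws where ws: "set ws \<subseteq> letters" "length ws = len x" "foldr (\<otimes>) ws \<one> = x"
    using len_word[OF assms(1)] .
  define y where "y = foldr (\<otimes>) (take j ws) \<one>"
  define z where "z = foldr (\<otimes>) (drop j ws) \<one>"
  have sub: "set (take j ws) \<subseteq> letters" "set (drop j ws) \<subseteq> letters"
    using ws(1) set_take_subset set_drop_subset by fast+
  then have yz: "y \<in> carrier G" "z \<in> carrier G" "x = y \<otimes> z"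
    using word_append[OF sub] ws(3) by (simp_all add: y_def z_def del: foldr_append)
  have "len y \<le> j"
    using mem_ballI[OF sub(1), of j] yz(1) by (simp add: len_le_iff y_def)
  moreover have "len z \<le> len x - j"
    using mem_ballI[OF sub(2), of "len x - j"] yz(2) ws(2) by (simp add: len_le_iff z_def)
  ultimately have "len y = j"
    using len_mult[OF yz(1,2)] yz(3) assms(2) by simp
  then show ?thesis
    using yz(1) by blast
qed

text \<open>Balls of radius \<open>r\<close> centred at elements whose lengths differ by more than \<open>2 * r\<close>
  are disjoint.\<close>

lemma packing:
  assumes "finite (carrier G)" "x \<in> carrier G"
  shows "(len x div (2 * r + 1) + 1) * card (ball r) \<le> card (carrier G)"
proof -
  \<comment> \<open>The centres have lengths \<open>0\<close>, \<open>2 * r + 1\<close>,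
    \<open>2 * (2 * r + 1)\<close> and so on; \<open>m\<close> is the number of such values not
    exceeding \<open>len x\<close>.\<close>
  define m where "m = len x div (2 * r + 1) + 1"
  have "\<exists>y\<in>carrier G. len y = i * (2 * r + 1)" if "i < m" for i
  proof (rule ex_len_eq[OF assms(2)])
    have "i \<le> len x div (2 * r + 1)"
      using that by (simp add: m_def)
    then show "i * (2 * r + 1) \<le> len x"
      by (meson dual_order.trans div_times_less_eq_dividend mult_le_mono1)
  qed
  then obtain f where f: "\<And>i. i < m \<Longrightarrow> f i \<in> carrier G \<and> len (f i) = i * (2 * r + 1)"
    by metis
  \<comment> \<open>If two balls meet, the lengths of their centres differ by at most
    \<open>2 * r\<close>, less than the spacing. Exchanging \<open>i\<close> and \<open>j\<close>
    turns this inequality into equality.\<close>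
  have near: "i \<le> j" if "i < m" "j < m" "b \<in> ball r" "c \<in> ball r" "f i \<otimes> b = f j \<otimes> c" for i j b c
  proof -
    have bc: "b \<in> carrier G" "c \<in> carrier G" "len b \<le> r" "len c \<le> r"
      using that ball_closed len_le_iff by blast+
    have "f i = f j \<otimes> c \<otimes> inv b"
      using that bc f[of i] f[of j] by (metis inv_solve_right' m_closed)
    then have "len (f i) \<le> len (f j) + len c + len (inv b)"
      using that bc f[of j] len_mult[of "f j \<otimes> c" "inv b"] len_mult[of "f j" c] by simp
    then have "i * (2 * r + 1) \<le> j * (2 * r + 1) + 2 * r"
      using that bc f[of i] f[of j] len_inv[of b] by simp
    then have "i * (2 * r + 1) < (j + 1) * (2 * r + 1)"
      by simp
    then show "i \<le> j"
      by (metis Suc_eq_plus1 less_Suc_eq_le mult_less_cancel2)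
  qed
  have "inj_on (\<lambda>(i, b). f i \<otimes> b) ({..<m} \<times> ball r)"
  proof (rule inj_onI, clarsimp)
    fix i j b c
    assume *: "i < m" "j < m" "b \<in> ball r" "c \<in> ball r" "f i \<otimes> b = f j \<otimes> c"
    then have "i = j"
      using near[of i j b c] near[of j i c b] by simp
    then show "i = j \<and> b = c"
      using * f[of j] ball_closed by (metis l_cancel subsetD)
  qed
  moreover have "(\<lambda>(i, b). f i \<otimes> b) ` ({..<m} \<times> ball r) \<subseteq> carrier G"
    using f ball_closed by auto
  ultimately have "card ({..<m} \<times> ball r) \<le> card (carrier G)"
    using assms(1) card_inj_on_le by blast
  then show ?thesis
    by (simp add: m_def card_cartesian_product)
qed

text \<open>The summand \<open>1\<close> accommodates radius 0, where the ball is a single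
  point.\<close>

definition linear_growth :: bool where
  "linear_growth \<longleftrightarrow> (\<exists>c::real. \<forall>n. real (card (ball n)) \<le> c * (real n + 1))"

end

section \<open>Infinite words\<close>

text \<open>This is Koenig's lemma for the tree of words satisfying \<open>P\<close>: the infinite
  word is built letter by letter through prefixes that have arbitrarily long extensions in
  \<open>P\<close>.\<close>

lemma infinite_word:
  fixes P :: "'a list \<Rightarrow> bool"
  assumes fin: "finite A"
    and letters: "\<And>ws. P ws \<Longrightarrow> set ws \<subseteq> A"
    and prefix: "\<And>us vs. P (us @ vs) \<Longrightarrow> P us"
    and long: "\<And>n. \<exists>ws. P ws \<and> n \<le> length ws"
  shows "\<exists>w. \<forall>n. P (map w [0..<n])"
proof -
  define ext where "ext us \<longleftrightarrow> (\<forall>n. \<exists>vs. n \<le> length vs \<and> P (us @ vs))" for us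
  have "ext []"
    using long by (auto simp: ext_def)
  have step: "\<exists>a. ext (us @ [a])" if ext: "ext us" for us
  proof (rule ccontr)
    assume "\<nexists>a. ext (us @ [a])"
    then have "\<forall>a. \<exists>n. \<forall>vs. P (us @ a # vs) \<longrightarrow> length vs < n"
      by (auto simp: ext_def) (meson not_le)
    then obtain N where N: "\<And>a vs. P (us @ a # vs) \<Longrightarrow> length vs < N a"
      by metis
    \<comment> \<open>Only letters of the finite set \<open>A\<close> can follow \<open>us\<close>,
      so their individual bounds have a maximum; \<open>insert 0\<close> covers an empty
      \<open>A\<close>, and \<open>Suc\<close> pays for the letter \<open>a\<close>.\<close>
    define n where "n = Suc (Max (insert 0 (N ` A)))"
    obtain vs where vs: "n \<le> length vs" "P (us @ vs)"
      using ext by (auto simp: ext_def)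
    then obtain a vs' where a: "vs = a # vs'"
      by (cases vs) (auto simp: n_def)
    have "a \<in> A"
      using letters[OF vs(2)] a by simp
    then have "N a \<le> Max (insert 0 (N ` A))"
      using fin by simp
    moreover have "length vs' < N a"
      using N vs a by blast
    ultimately show False
      using vs a by (simp add: n_def)
  qed
  define nxt where "nxt us = (SOME a. ext (us @ [a]))" for us
  define pre where "pre = rec_nat [] (\<lambda>_ us. us @ [nxt us])"
  have pre: "pre 0 = []" "\<And>n. pre (Suc n) = pre n @ [nxt (pre n)]"
    by (simp_all add: pre_def)
  have "pre n = map (\<lambda>i. nxt (pre i)) [0..<n]" for n
    by (induction n) (simp_all add: pre)
  moreover have "ext (pre n)" for n
  proof (induction n)
    case (Suc n)
    then show ?case
      using someI_ex[OF step] by (simp add: pre(2) nxt_def)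
  qed (simp add: pre \<open>ext []\<close>)
  then have "P (pre n)" for n
    using prefix by (auto simp: ext_def)
  ultimately show ?thesis
    by metis
qed

text \<open>The cardinality of this set, as a function of \<open>r\<close>, is the factor complexity
  of \<open>w\<close>.\<close>

definition word_factors :: "(nat \<Rightarrow> 'a) \<Rightarrow> nat \<Rightarrow> 'a list set" where
  "word_factors w r = range (\<lambda>n. map w [n..<n + r])"

lemma take_word_factors: "take r ` word_factors w (Suc r) = word_factors w r"
  by (simp add: word_factors_def image_image take_map del: upt_Suc)

text \<open>If the complexity does not grow at \<open>r\<close>, truncation from length
  \<open>r + 1\<close> to length \<open>r\<close> is injective, so a factor of length
  \<open>r\<close> determines the letter after it. By the pigeonhole principle some factor of length
  \<open>r\<close> occurs at two positions, and from there on the word repeats.\<close>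

lemma Morse_Hedlund:
  fixes w :: "nat \<Rightarrow> 'a"
  assumes fin: "finite (word_factors w (Suc r))" and le: "card (word_factors w (Suc r)) \<le> card (word_factors w r)"
  obtains m q where "0 < q" "\<And>i. w (m + i + q) = w (m + i)"
proof -
  have inj: "inj_on (take r) (word_factors w (Suc r))"
    using fin le card_image_le[OF fin, of "take r"]
    by (intro eq_card_imp_inj_on) (simp_all add: take_word_factors)
  have det: "map w [Suc m..<Suc m + r] = map w [Suc n..<Suc n + r]"
    if "map w [m..<m + r] = map w [n..<n + r]" for m n
  proof -
    have eq: "map w [m..<m + Suc r] = map w [n..<n + Suc r]"
      by (rule inj_onD[OF inj]) (use that in \<open>simp_all add: word_factors_def take_map del: upt_Suc\<close>)
    have "tl (map w [k..<k + Suc r]) = map w [Suc k..<Suc k + r]" for k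
      by (simp add: map_tl[symmetric] tl_upt del: upt_Suc)
    then show ?thesis
      using eq by metis
  qed
  have "finite (word_factors w r)"
    using fin by (metis finite_imageI take_word_factors)
  then have "\<not> inj (\<lambda>n. map w [n..<n + r])"
    unfolding word_factors_def using finite_imageD infinite_UNIV_nat by blast
  then obtain m n where mn: "m < n" "map w [m..<m + r] = map w [n..<n + r]"
    unfolding inj_def by (metis nat_neq_iff)
  have shift: "map w [m + i..<m + i + r] = map w [n + i..<n + i + r]" for i
  proof (induction i)
    case (Suc i)
    then show ?case
      using det[of "m + i" "n + i"] by (simp only: add_Suc_right)
  qed (use mn(2) in simp)
  have ev: "w (m + i) = w (n + i)" for i
  proof -
    \<comment> \<open>The window has length \<open>Suc r\<close>, so it is nonempty even for
      \<open>r = 0\<close> and its first letters can be compared.\<close>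
    have "map w [m + i..<m + i + Suc r] = map w [n + i..<n + i + Suc r]"
      by (rule inj_onD[OF inj]) (use shift[of i] in \<open>simp_all add: word_factors_def take_map del: upt_Suc\<close>)
    then show ?thesis
      by (simp add: upt_conv_Cons del: upt_Suc)
  qed
  show thesis
  proof (rule that)
    show "0 < n - m"
      using mn(1) by simp
    show "w (m + i + (n - m)) = w (m + i)" for i
      using ev[of i] mn(1) by (simp add: add.commute add.left_commute)
  qed
qed

text \<open>In this form, evaluation in a group turns factors of a periodic word into powers of the
  value of its period.\<close>

lemma periodic_factor:
  assumes "\<And>i. w (m + i + q) = w (m + i)"
  shows "map w [m..<m + k * q] = concat (replicate k (map w [m..<m + q]))"
proof (induction k)
  case (Suc k)
  have "w (m + i + k * q) = w (m + i)" for i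
  proof (induction k)
    case (Suc k)
    then show ?case
      using assms[of "i + k * q"] by (simp add: algebra_simps)
  qed simp
  then have "map w [m + k * q..<m + k * q + q] = map w [m..<m + q]"
    by (intro nth_equalityI) (simp_all add: algebra_simps)
  moreover have "[m..<m + Suc k * q] = [m..<m + k * q] @ [m + k * q..<m + k * q + q]"
    using upt_add_eq_append[of m "m + k * q" q] by (simp add: algebra_simps)
  moreover have "replicate (Suc k) (map w [m..<m + q]) = replicate k (map w [m..<m + q]) @ [map w [m..<m + q]]"
    by (simp add: replicate_append_same)
  ultimately show ?case
    using Suc by (simp del: replicate_Suc)
qed simp

text \<open>Well-foundedness provides a least word for each group element and totality makes it
  unique; compatibility with contexts passes minimality to factors, and comparing lengths first puts
  the empty word below all others.\<close>

lemma ex_short_lex_order: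
  obtains R :: "('a list \<times> 'a list) set" where
    "wf R" "total R"
    "\<And>us xs ys vs. (xs, ys) \<in> R \<Longrightarrow> (us @ xs @ vs, us @ ys @ vs) \<in> R"
    "\<And>xs ys. length xs < length ys \<Longrightarrow> (xs, ys) \<in> R"
proof -
  \<comment> \<open>The letters range over a whole type, so their order comes from the well-ordering
    theorem.\<close>
  obtain r :: "'a rel" where r: "Well_order r" "Field r = UNIV"
    using well_ordering[where 'a = 'a] by blast
  define s where "s = r - Id"
  have "well_order_on UNIV r"
    using r by metis
  then have s: "wf s" "total s"
    by (simp_all add: s_def well_order_on_def linear_order_on_def)
  show thesis
  proof (rule that)
    show "wf (lenlex s)"
      using s by blast
    show "total (lenlex s)"
      using s by (simp add: total_lenlex)
    have "irrefl s"
      by (simp add: s_def irrefl_def)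
    then show "(us @ xs @ vs, us @ ys @ vs) \<in> lenlex s" if "(xs, ys) \<in> lenlex s" for us xs ys vs
      using that lenlex_append1[OF that, of vs vs] by simp
    show "(xs, ys) \<in> lenlex s" if "length xs < length ys" for xs ys
      using that by (simp add: lenlex_conv)
  qed
qed

section \<open>Linear growth and virtual cyclicity\<close>

context finitely_generated_group
begin

lemma ex_infinite_order:
  assumes "infinite (carrier G)" "linear_growth"
  obtains g where "g \<in> carrier G" "\<And>n::nat. 0 < n \<Longrightarrow> g [^] n \<noteq> \<one>"
proof -
  obtain R :: "('a list \<times> 'a list) set" where R: "wf R" "total R"
    and R_app: "\<And>us xs ys vs. (xs, ys) \<in> R \<Longrightarrow> (us @ xs @ vs, us @ ys @ vs) \<in> R"
    and R_len: "\<And>xs ys. length xs < length ys \<Longrightarrow> (xs, ys) \<in> R"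
    by (rule ex_short_lex_order[where 'a = 'a]) blast
  define eval where "eval ws = foldr (\<otimes>) ws \<one>" for ws
  \<comment> \<open>The normal form of a group element is the \<open>R\<close>-least word over
    \<open>letters\<close> that represents it.\<close>
  define nf where "nf ws \<longleftrightarrow> set ws \<subseteq> letters \<and>
    (\<forall>vs. set vs \<subseteq> letters \<and> eval vs = eval ws \<longrightarrow> (vs, ws) \<notin> R)" for ws
  have nf_letters: "set ws \<subseteq> letters" if "nf ws" for ws
    using that by (simp add: nf_def)
  have eval_append: "eval (us @ vs) = eval us \<otimes> eval vs" if "set us \<subseteq> letters" "set vs \<subseteq> letters" for us vs
    unfolding eval_def using that by (rule word_append)
  \<comment> \<open>Replacing a factor by a smaller word of the same value would make the whole word
    smaller without changing its value.\<close>
  have nf_factor: "nf xs" if "nf (us @ xs @ vs)" for us xs vs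
    unfolding nf_def
  proof (intro conjI allI impI)
    have sub: "set us \<subseteq> letters" "set xs \<subseteq> letters" "set vs \<subseteq> letters"
      using nf_letters[OF that] by auto
    then show "set xs \<subseteq> letters"
      by simp
    fix ys assume ys: "set ys \<subseteq> letters \<and> eval ys = eval xs"
    then have "eval (us @ ys @ vs) = eval (us @ xs @ vs)"
      using sub by (simp add: eval_append)
    moreover have "set (us @ ys @ vs) \<subseteq> letters"
      using sub ys by simp
    ultimately show "(ys, xs) \<notin> R"
      using that R_app unfolding nf_def by blast
  qed
  have nf_inj: "xs = ys" if "nf xs" "nf ys" "eval xs = eval ys" for xs ys
    using that R(2) unfolding nf_def total_on_def by (metis UNIV_I)
  have ex_nf: "\<exists>ws. nf ws \<and> eval ws = x" if x: "x \<in> carrier G" for x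
  proof -
    obtain us where "set us \<subseteq> letters" "eval us = x"
      unfolding eval_def by (rule len_word[OF x])
    then have "{ws. set ws \<subseteq> letters \<and> eval ws = x} \<noteq> {}"
      by blast
    then obtain ws where "ws \<in> {ws. set ws \<subseteq> letters \<and> eval ws = x}"
      "\<And>vs. (vs, ws) \<in> R \<Longrightarrow> vs \<notin> {ws. set ws \<subseteq> letters \<and> eval ws = x}"
      by (rule wfE_min'[OF R(1)]) blast
    then show ?thesis
      by (intro exI[of _ ws]) (auto simp: nf_def)
  qed
  \<comment> \<open>The group is infinite and balls are finite, so some element lies outside
    \<open>ball n\<close>; its normal form has more than \<open>n\<close> letters.\<close>
  have long: "\<exists>ws. nf ws \<and> n \<le> length ws" for n
  proof -
    obtain x where x: "x \<in> carrier G" "x \<notin> ball n"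
      using assms(1) finite_ball ball_closed by (metis finite_subset subsetI)
    obtain ws where ws: "nf ws" "eval ws = x"
      using ex_nf[OF x(1)] by blast
    have "\<not> length ws \<le> n"
      using x(2) ws(2) mem_ballI[OF nf_letters[OF ws(1)], of n] by (auto simp: eval_def)
    then show ?thesis
      using ws(1) by (intro exI[of _ ws]) simp
  qed
  have "\<exists>w. \<forall>n. nf (map w [0..<n])"
  proof (rule infinite_word[OF finite_letters nf_letters _ long])
    show "nf us" if "nf (us @ vs)" for us vs
      using nf_factor[of "[]" us vs] that by simp
  qed
  then obtain w where w: "\<And>n. nf (map w [0..<n])"
    by blast
  have w_factor: "nf (map w [m..<m + r])" for m r
  proof -
    have "map w [0..<m + r] = map w [0..<m] @ map w [m..<m + r] @ []"
      using upt_add_eq_append[of 0 m r] by simp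
    then show ?thesis
      using w[of "m + r"] nf_factor by metis
  qed
  have nf_word_factors: "nf xs" and length_word_factors: "length xs = r" if "xs \<in> word_factors w r" for xs r
    using that w_factor by (auto simp: word_factors_def)
  have fin: "finite (word_factors w r)" for r
    by (rule finite_subset[OF _ finite_lists_length_eq[OF finite_letters, of r]])
      (use nf_word_factors nf_letters length_word_factors in blast)
  \<comment> \<open>Factors of different lengths are different words, and distinct normal forms have
    distinct values. Hence all factors of length at most \<open>n\<close> together inject into
    \<open>ball n\<close>.\<close>
  have sum_le: "(\<Sum>r\<le>n. card (word_factors w r)) \<le> card (ball n)" for n
  proof -
    have "(\<Sum>r\<le>n. card (word_factors w r)) = card (\<Union>r\<le>n. word_factors w r)"
      by (rule card_UN_disjoint[symmetric]) (use fin length_word_factors in \<open>simp, simp, blast\<close>)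
    also have "\<dots> \<le> card (ball n)"
    proof (rule card_inj_on_le[OF _ _ finite_ball])
      show "inj_on eval (\<Union>r\<le>n. word_factors w r)"
        by (rule inj_onI) (use nf_word_factors nf_inj in blast)
      show "eval ` (\<Union>r\<le>n. word_factors w r) \<subseteq> ball n"
      proof clarify
        fix xs r
        assume "r \<le> n" "xs \<in> word_factors w r"
        then show "eval xs \<in> ball n"
          unfolding eval_def
          using nf_letters[OF nf_word_factors] length_word_factors by (intro mem_ballI) auto
      qed
    qed
    finally show ?thesis .
  qed
  \<comment> \<open>Otherwise the complexity at \<open>r\<close> would be at least \<open>r\<close>,
    and the sum up to \<open>n\<close> at least \<open>n * (n + 1) / 2\<close>, beyond any linear
    bound.\<close>
  have "\<exists>r. card (word_factors w (Suc r)) \<le> card (word_factors w r)"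
  proof (rule ccontr)
    assume "\<nexists>r. card (word_factors w (Suc r)) \<le> card (word_factors w r)"
    then have inc: "card (word_factors w r) < card (word_factors w (Suc r))" for r
      by (meson not_le)
    have ge: "r \<le> card (word_factors w r)" for r
    proof (induction r)
      case (Suc r)
      then show ?case
        using inc[of r] by simp
    qed simp
    obtain c where c: "\<And>n. real (card (ball n)) \<le> c * (real n + 1)"
      using assms(2) by (auto simp: linear_growth_def)
    obtain n :: nat where n: "2 * c < real n"
      using reals_Archimedean2 by blast
    have "real n * (real n + 1) = 2 * real (\<Sum>r\<le>n. r)"
      by (induction n) (simp_all add: algebra_simps)
    also have "real (\<Sum>r\<le>n. r) \<le> real (card (ball n))"
      by (rule of_nat_mono[OF order_trans[OF sum_mono sum_le]]) (rule ge)
    finally have "real n * (real n + 1) \<le> 2 * (c * (real n + 1))"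
      using c[of n] by linarith
    then show False
      using n mult_less_cancel_right[of "2 * c" "real n + 1" "real n"] by (simp add: mult.assoc)
  qed
  then obtain r where "card (word_factors w (Suc r)) \<le> card (word_factors w r)" ..
  then obtain m q where q: "0 < q" "\<And>i. w (m + i + q) = w (m + i)"
    by (rule Morse_Hedlund[OF fin]) blast
  define v where "v = map w [m..<m + q]"
  have v: "set v \<subseteq> letters" "set v \<subseteq> carrier G"
    using nf_letters[OF w_factor] letters_closed unfolding v_def by blast+
  show thesis
  proof (rule that)
    show "eval v \<in> carrier G"
      using v by (simp add: eval_def)
    fix n :: nat assume "0 < n"
    \<comment> \<open>The \<open>n\<close>-fold repetition of the period is a factor of
      \<open>w\<close>, hence minimal. If its value were \<open>\<one>\<close>, the empty word would
      be a smaller representative.\<close>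
    have nf: "nf (concat (replicate n v))"
      using w_factor[of m "n * q"] periodic_factor[of w m q n, OF q(2)] by (simp add: v_def)
    have "length (concat (replicate n v)) = n * q"
      by (simp add: v_def length_concat sum_list_replicate)
    then have "([], concat (replicate n v)) \<in> R"
      using R_len \<open>0 < n\<close> q(1) by simp
    then have "eval (concat (replicate n v)) \<noteq> eval []"
      using nf unfolding nf_def by (metis empty_set empty_subsetI)
    then show "eval v [^] n \<noteq> \<one>"
      using foldr_mult_concat_replicate[OF v(2), of n] by (simp add: eval_def del: foldr_append)
  qed
qed

text \<open>The number of cosets met by a ball grows strictly with the radius: if
  \<open>ball (Suc n)\<close> met no new coset, the cosets met by \<open>ball n\<close> would be
  closed under right multiplication by letters, so they would be all of the infinitely many
  cosets.\<close>

lemma card_cosets_ball: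
  assumes "subgroup H G" "infinite (rcosets H)"
  shows "n + 1 \<le> card ((\<lambda>x. H #> x) ` ball n)"
proof -
  define N where "N n = (\<lambda>x. H #> x) ` ball n" for n
  have H: "H \<subseteq> carrier G"
    using assms(1) by (rule subgroup.subset)
  have fin: "finite (N n)" for n
    by (simp add: N_def finite_ball)
  have grow: "\<not> N (Suc n) \<subseteq> N n" for n
  proof
    assume sub: "N (Suc n) \<subseteq> N n"
    have cos: "H #> foldr (\<otimes>) ws \<one> \<in> N n" if "set ws \<subseteq> letters" for ws
      using that
    \<comment> \<open>Letters act on the cosets of \<open>H\<close> from the right, so words are
      extended at their right end.\<close>
    proof (induction ws rule: rev_induct)
      case Nil
      then show ?case
        using one_in_ball by (simp add: N_def)
    next
      case (snoc a ws)
      then have a: "a \<in> letters" "a \<in> carrier G" and ws: "set ws \<subseteq> letters"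
        using letters_closed by auto
      obtain y where y: "y \<in> ball n" "H #> foldr (\<otimes>) ws \<one> = H #> y"
        using snoc.IH[OF ws] by (auto simp: N_def)
      have yc: "y \<in> carrier G"
        using y(1) ball_closed by blast
      have "foldr (\<otimes>) (ws @ [a]) \<one> = foldr (\<otimes>) ws \<one> \<otimes> a"
        using word_append[of ws "[a]"] ws a by (simp del: foldr_append)
      then have "H #> foldr (\<otimes>) (ws @ [a]) \<one> = H #> (y \<otimes> a)"
        using y(2) yc a(2) ws H word_closed[OF ws] by (simp del: foldr_append flip: coset_mult_assoc)
      moreover have "y \<otimes> a \<in> ball (Suc n)"
        using ball_mult[OF y(1) letter_in_ball[OF a(1)]] by simp
      ultimately show ?case
        using sub by (auto simp: N_def)
    qed
    have "rcosets H \<subseteq> N n"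
    proof
      fix C assume "C \<in> rcosets H"
      then obtain x where x: "x \<in> carrier G" "C = H #> x"
        by (auto simp: RCOSETS_def)
      obtain ws where "set ws \<subseteq> letters" "foldr (\<otimes>) ws \<one> = x"
        by (rule len_word[OF x(1)])
      then show "C \<in> N n"
        using cos x(2) by blast
    qed
    then show False
      using assms(2) fin finite_subset by blast
  qed
  have "n + 1 \<le> card (N n)" for n
  proof (induction n)
    case 0
    have "N 0 \<noteq> {}"
      using one_in_ball by (auto simp: N_def)
    then show ?case
      using fin[of 0] by (simp add: Suc_le_eq card_gt_0_iff)
  next
    case (Suc n)
    have "N n \<subset> N (Suc n)"
      using grow[of n] image_mono[OF ball_mono[of n "Suc n"], of "\<lambda>x. H #> x"] by (simp add: N_def psubset_eq)
    then have "card (N n) < card (N (Suc n))"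
      by (rule psubset_card_mono[OF fin])
    then show ?case
      using Suc by simp
  qed
  then show ?thesis
    by (simp add: N_def)
qed

text \<open>With infinitely many cosets, the products of \<open>n + 1\<close> powers of
  \<open>g\<close> with representatives of at least \<open>n + 1\<close> cosets are distinct. They
  lie in a ball of radius linear in \<open>n\<close>, so growth would be at least quadratic.\<close>

lemma infinite_order_imp_finite_index:
  assumes "linear_growth" and g: "g \<in> carrier G" and ord: "\<And>n::nat. 0 < n \<Longrightarrow> g [^] n \<noteq> \<one>"
  shows "finite_index G (generate G {g})"
proof (rule ccontr)
  define H where "H = generate G {g}"
  assume "\<not> finite_index G (generate G {g})"
  then have inf: "infinite (rcosets H)"
    by (simp add: finite_index_def H_def)
  have sub: "subgroup H G"
    unfolding H_def using g by (intro generate_is_subgroup) simp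
  have gH: "g [^] j \<in> H" for j :: nat
  proof -
    have "g \<in> H"
      by (simp add: H_def generate.incl)
    then show ?thesis
      using sub by (induction j) (auto simp: subgroup.one_closed subgroup.m_closed)
  qed
  have "g [^] i \<noteq> g [^] j" if "i < j" for i j :: nat
  proof
    assume eq: "g [^] i = g [^] j"
    have "g [^] i \<otimes> g [^] (j - i) = g [^] j"
      using nat_pow_mult[OF g, of i "j - i"] \<open>i < j\<close> by simp
    then have "g [^] i \<otimes> g [^] (j - i) = g [^] i \<otimes> \<one>"
      using eq g r_one[of "g [^] i"] by (metis nat_pow_closed)
    then have "g [^] (j - i) = \<one>"
      using g by (simp only: l_cancel nat_pow_closed one_closed)
    then show False
      using ord[of "j - i"] \<open>i < j\<close> by simp
  qed
  then have pow_inj: "i = j" if "g [^] i = g [^] j" for i j :: nat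
    using that by (metis nat_neq_iff)
  obtain l where l: "g \<in> ball l"
    using ex_ball[OF g] by blast
  obtain c where c: "\<And>n. real (card (ball n)) \<le> c * (real n + 1)"
    using assms(1) by (auto simp: linear_growth_def)
  have "real n + 1 \<le> c * (real l + 1)" for n
  proof -
    define N where "N = (\<lambda>x. H #> x) ` ball n"
    have "\<forall>C\<in>N. \<exists>x. x \<in> ball n \<and> H #> x = C"
      by (auto simp: N_def)
    then obtain rep where rep: "\<And>C. C \<in> N \<Longrightarrow> rep C \<in> ball n \<and> H #> rep C = C"
      by metis
    have rep_closed: "rep C \<in> carrier G" if "C \<in> N" for C
      using rep[OF that] ball_closed by blast
    \<comment> \<open>Left multiplication by a power of \<open>g\<close> stays in the coset, so a
      product determines \<open>C\<close>, hence \<open>rep C\<close>, and then the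
      exponent.\<close>
    have coset: "H #> (g [^] j \<otimes> rep C) = C" if "C \<in> N" for C and j :: nat
    proof -
      have "H #> (g [^] j \<otimes> rep C) = (H #> g [^] j) #> rep C"
        using coset_mult_assoc[OF subgroup.subset[OF sub]] rep_closed[OF that] g by simp
      also have "\<dots> = C"
        using coset_join2[OF _ sub gH] g rep[OF that] by simp
      finally show ?thesis .
    qed
    have "inj_on (\<lambda>(j, C). g [^] j \<otimes> rep C) ({..n} \<times> N)"
    proof (rule inj_onI, clarsimp)
      fix i j C D
      assume *: "C \<in> N" "D \<in> N" "g [^] (i::nat) \<otimes> rep C = g [^] (j::nat) \<otimes> rep D"
      then have "C = D"
        using coset[of C i] coset[of D j] by simp
      then show "i = j \<and> C = D"
        using * rep_closed[of D] pow_inj[of i j] g by simp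
    qed
    moreover have "(\<lambda>(j, C). g [^] j \<otimes> rep C) ` ({..n} \<times> N) \<subseteq> ball (n * l + n)"
    proof clarsimp
      fix j C assume "j \<le> n" "C \<in> N"
      then have "g [^] j \<otimes> rep C \<in> ball (j * l + n)"
        using ball_mult[OF ball_pow[OF l]] rep by blast
      moreover have "j * l + n \<le> n * l + n"
        using \<open>j \<le> n\<close> by simp
      ultimately show "g [^] j \<otimes> rep C \<in> ball (n * l + n)"
        using ball_mono[of "j * l + n" "n * l + n"] by blast
    qed
    ultimately have "card ({..n} \<times> N) \<le> card (ball (n * l + n))"
      using finite_ball card_inj_on_le by blast
    moreover have "(n + 1) * (n + 1) \<le> card ({..n} \<times> N)"
      using mult_le_mono[OF order_refl card_cosets_ball[OF sub inf, of n], of "n + 1"]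
      by (simp add: card_cartesian_product N_def)
    ultimately have "real ((n + 1) * (n + 1)) \<le> real (card (ball (n * l + n)))"
      by (meson of_nat_mono order_trans)
    also have "\<dots> \<le> c * (real (n * l + n) + 1)"
      by (rule c)
    also have "\<dots> \<le> c * ((real l + 1) * (real n + 1))"
    proof (rule mult_left_mono)
      show "0 \<le> c"
        using order_trans[OF of_nat_0_le_iff c[of 0]] by simp
    qed (simp add: algebra_simps)
    finally have "(real n + 1) * (real n + 1) \<le> (c * (real l + 1)) * (real n + 1)"
      by (simp only: of_nat_mult of_nat_add of_nat_1 mult.assoc)
    then show ?thesis
      by (rule mult_right_le_imp_le) simp
  qed
  moreover obtain n :: nat where "c * (real l + 1) < real n"
    using reals_Archimedean2 by blast
  ultimately show False
    by (metis add_increasing2 linorder_not_less order_refl zero_le_one order_trans)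
qed

lemma generate_singleton_virtually_cyclic:
  assumes "g \<in> carrier G" "finite_index G (generate G {g})"
  shows "virtually_cyclic G"
proof -
  have sub: "subgroup (generate G {g}) G"
    using assms(1) by (intro generate_is_subgroup) simp
  have "carrier G \<inter> {g} = {g}"
    using assms(1) by simp
  \<comment> \<open>\<open>virtually_cyclic\<close> speaks of the structure generated by the whole
    subgroup; it coincides with the one generated by \<open>g\<close> alone, which is
    cyclic.\<close>
  then have "subgroup_generated G (generate G {g}) = subgroup_generated G {g}"
    using subgroup.carrier_subgroup_generated_subgroup[OF sub]
    by (simp add: carrier_subgroup_generated) (simp add: subgroup_generated_def)
  then show ?thesis
    using sub assms(2) cyclic_group_generated[of g] unfolding virtually_cyclic_def by metis
qed

text \<open>Inverses of right coset representatives form a left transversal. The cyclic factor thus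
  stands on the right and is untouched when letters are multiplied on the left.\<close>

lemma ex_finite_transversal:
  assumes "virtually_cyclic G"
  obtains T h where "finite T" "h \<in> carrier G" "T \<subseteq> carrier G"
    "\<And>x. x \<in> carrier G \<Longrightarrow> \<exists>t\<in>T. \<exists>k::int. x = t \<otimes> h [^] k"
proof -
  obtain H where H: "subgroup H G" "finite (rcosets H)" "cyclic_group (subgroup_generated G H)"
    using assms by (auto simp: virtually_cyclic_def finite_index_def)
  have cH: "carrier (subgroup_generated G H) = H"
    by (rule subgroup.carrier_subgroup_generated_subgroup[OF H(1)])
  obtain h where h: "h \<in> H" "H = range (\<lambda>k::int. h [^]\<^bsub>subgroup_generated G H\<^esub> k)"
    using H(3) group.cyclic_group[OF group_subgroup_generated] cH by metis
  then have H_eq: "H = range (\<lambda>k::int. h [^] k)"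
    using int_pow_subgroup_generated[of h H] cH by simp
  have hc: "h \<in> carrier G"
    using h(1) H(1) subgroup.mem_carrier by metis
  have "\<forall>C\<in>rcosets H. \<exists>r. r \<in> carrier G \<and> C = H #> r"
    by (auto simp: RCOSETS_def)
  then obtain rep where rep: "\<And>C. C \<in> rcosets H \<Longrightarrow> rep C \<in> carrier G \<and> C = H #> rep C"
    by metis
  show thesis
  proof (rule that)
    show "finite ((\<lambda>C. inv (rep C)) ` (rcosets H))"
      using H(2) by simp
    show "(\<lambda>C. inv (rep C)) ` (rcosets H) \<subseteq> carrier G"
      using rep by auto
    fix x assume x: "x \<in> carrier G"
    define C where "C = H #> inv x"
    have C: "C \<in> rcosets H"
      unfolding C_def using x subgroup.subset[OF H(1)] by (intro rcosetsI) auto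
    have "inv x \<in> H #> rep C"
      using rep[OF C] rcos_self[OF inv_closed[OF x] H(1)] by (simp add: C_def)
    then obtain k :: int where k: "inv x = h [^] k \<otimes> rep C"
      unfolding r_coset_def using H_eq by auto
    have "x = inv (h [^] k \<otimes> rep C)"
      using x k by (metis inv_inv)
    also have "\<dots> = inv (rep C) \<otimes> h [^] (- k)"
      using rep[OF C] hc by (simp add: inv_mult_group int_pow_neg)
    finally show "\<exists>t\<in>(\<lambda>C. inv (rep C)) ` (rcosets H). \<exists>k::int. x = t \<otimes> h [^] k"
      using C by (intro bexI[of _ "inv (rep C)"] exI[of _ "- k"]) auto
  qed (rule hc)
qed

text \<open>Left multiplication of \<open>t \<otimes> h [^] k\<close> by a letter replaces
  \<open>t\<close> by another element of \<open>T\<close> and shifts the exponent by a bounded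
  amount. A ball of radius \<open>n\<close> therefore involves finitely many \<open>t\<close> and a
  number of exponents linear in \<open>n\<close>.\<close>

lemma virtually_cyclic_imp_linear_growth:
  assumes "virtually_cyclic G"
  shows "linear_growth"
proof -
  obtain T h where T: "finite T" "h \<in> carrier G" "T \<subseteq> carrier G"
    "\<And>x. x \<in> carrier G \<Longrightarrow> \<exists>t\<in>T. \<exists>k::int. x = t \<otimes> h [^] k"
    using ex_finite_transversal[OF assms] by blast
  obtain \<tau> \<epsilon> where \<tau>: "\<And>x. x \<in> carrier G \<Longrightarrow> \<tau> x \<in> T \<and> x = \<tau> x \<otimes> h [^] (\<epsilon> x :: int)"
    using T(4) by metis
  \<comment> \<open>The maximum \<open>E\<close> of this set bounds both the exponent used to write
    \<open>\<one>\<close> and the shift caused by any single letter.\<close>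
  define F where "F = insert 0 ((\<lambda>x. nat \<bar>\<epsilon> x\<bar>) ` insert \<one> ((\<lambda>(a, t). a \<otimes> t) ` (letters \<times> T)))"
  define E where "E = Max F"
  have "finite F"
    unfolding F_def using T(1) finite_letters by simp
  then have E: "nat \<bar>\<epsilon> \<one>\<bar> \<le> E" "\<And>a t. a \<in> letters \<Longrightarrow> t \<in> T \<Longrightarrow> nat \<bar>\<epsilon> (a \<otimes> t)\<bar> \<le> E"
    unfolding E_def by (auto intro!: Max_ge simp: F_def)
  \<comment> \<open>The \<open>1\<close> added to the length accounts for the exponent already
    present in the representation of \<open>\<one>\<close>.\<close>
  have word: "\<exists>t\<in>T. \<exists>k::int. \<bar>k\<bar> \<le> int (E * (length ws + 1)) \<and> foldr (\<otimes>) ws \<one> = t \<otimes> h [^] k"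
    if "set ws \<subseteq> letters" for ws
    using that
  proof (induction ws)
    case Nil
    then show ?case
      using \<tau>[OF one_closed] E(1) by (intro bexI[of _ "\<tau> \<one>"] exI[of _ "\<epsilon> \<one>"]) auto
  next
    case (Cons a ws)
    then obtain t k where t: "t \<in> T" "\<bar>k\<bar> \<le> int (E * (length ws + 1))" "foldr (\<otimes>) ws \<one> = t \<otimes> h [^] (k::int)"
      by auto
    have a: "a \<in> letters" "a \<in> carrier G" and tc: "t \<in> carrier G"
      using Cons.prems letters_closed t(1) T(3) by auto
    then have at: "\<tau> (a \<otimes> t) \<in> T" "a \<otimes> t = \<tau> (a \<otimes> t) \<otimes> h [^] \<epsilon> (a \<otimes> t)"
      using \<tau>[of "a \<otimes> t"] by auto
    have "foldr (\<otimes>) (a # ws) \<one> = (a \<otimes> t) \<otimes> h [^] k"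
      using a tc T(2) t(3) by (simp add: m_assoc)
    also have "\<dots> = \<tau> (a \<otimes> t) \<otimes> h [^] (\<epsilon> (a \<otimes> t) + k)"
      using at T(2,3) m_assoc[of "\<tau> (a \<otimes> t)" "h [^] \<epsilon> (a \<otimes> t)" "h [^] k"]
      by (metis int_pow_closed int_pow_mult subsetD)
    finally have "foldr (\<otimes>) (a # ws) \<one> = \<tau> (a \<otimes> t) \<otimes> h [^] (\<epsilon> (a \<otimes> t) + k)" .
    moreover have "\<bar>\<epsilon> (a \<otimes> t) + k\<bar> \<le> int (E * (length (a # ws) + 1))"
      using t(2) E(2)[OF a(1) t(1)] by (simp add: algebra_simps)
    ultimately show ?case
      using at(1) by blast
  qed
  have "real (card (ball n)) \<le> (2 * real (card T) * (real E + 1)) * (real n + 1)" for n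
  proof -
    define I where "I = {- int (E * (n + 1))..int (E * (n + 1))}"
    have "ball n \<subseteq> (\<lambda>(t, k). t \<otimes> h [^] k) ` (T \<times> I)"
    proof
      fix x assume "x \<in> ball n"
      then obtain ws where ws: "set ws \<subseteq> letters" "length ws \<le> n" "x = foldr (\<otimes>) ws \<one>"
        by (rule mem_ballE)
      obtain t k where t: "t \<in> T" "\<bar>k\<bar> \<le> int (E * (length ws + 1))" "x = t \<otimes> h [^] (k::int)"
        using word[OF ws(1)] ws(3) by blast
      have "E * (length ws + 1) \<le> E * (n + 1)"
        using ws(2) by simp
      then have "k \<in> I"
        using t(2) unfolding I_def by (simp only: atLeastAtMost_iff) linarith
      then show "x \<in> (\<lambda>(t, k). t \<otimes> h [^] k) ` (T \<times> I)"
        using t by (intro image_eqI[of _ _ "(t, k)"]) auto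
    qed
    then have "card (ball n) \<le> card (T \<times> I)"
      using T(1) by (intro surj_card_le) (auto simp: I_def)
    also have "\<dots> = card T * (2 * (E * (n + 1)) + 1)"
      by (simp add: card_cartesian_product I_def nat_add_distrib nat_mult_distrib)
    also have "\<dots> \<le> card T * (2 * ((E + 1) * (n + 1)))"
      by (intro mult_left_mono) (simp_all add: algebra_simps)
    finally have "real (card (ball n)) \<le> real (card T * (2 * ((E + 1) * (n + 1))))"
      by (rule of_nat_mono)
    then show ?thesis
      by (simp add: algebra_simps)
  qed
  then show ?thesis
    unfolding linear_growth_def by blast
qed

text \<open>A finite group has the trivial subgroup as a cyclic subgroup of finite index; an element
  of infinite order is sought only in an infinite group.\<close>

lemma linear_growth_imp_virtually_cyclic:
  assumes "linear_growth"
  shows "virtually_cyclic G"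
proof (cases "finite (carrier G)")
  case True
  have "rcosets (generate G {\<one>}) \<subseteq> Pow (carrier G)"
    using rcosets_part_G[OF generate_is_subgroup[of "{\<one>}"]] by auto
  then have "finite_index G (generate G {\<one>})"
    using True finite_subset unfolding finite_index_def by blast
  then show ?thesis
    by (rule generate_singleton_virtually_cyclic[OF one_closed])
next
  case False
  then obtain g where "g \<in> carrier G" "\<And>n::nat. 0 < n \<Longrightarrow> g [^] n \<noteq> \<one>"
    using ex_infinite_order[OF _ assms] by blast
  then show ?thesis
    using generate_singleton_virtually_cyclic infinite_order_imp_finite_index[OF assms] by blast
qed

section \<open>Quotients\<close>

lemma quotient_group_hom: "N \<lhd> G \<Longrightarrow> group_hom G (G Mod N) (\<lambda>x. N #> x)"
  by (intro group_hom.intro group_hom_axioms.intro normal.factorgroup_is_group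
      normal.r_coset_hom_Mod is_group)

lemma finitely_generated_quotient:
  assumes "N \<lhd> G"
  shows "finitely_generated_group (G Mod N) ((\<lambda>s. N #> s) ` S)"
proof -
  interpret \<pi>: group_hom G "G Mod N" "\<lambda>x. N #> x"
    using assms by (rule quotient_group_hom)
  have "generate (G Mod N) ((\<lambda>s. N #> s) ` S) = carrier (G Mod N)"
    using \<pi>.generate_img[OF S_closed] by (simp add: generate_S carrier_FactGroup)
  then have "finite_generating_set (G Mod N) ((\<lambda>s. N #> s) ` S)"
    using finite_S S_closed by (auto simp: finite_generating_set_def carrier_FactGroup)
  then show ?thesis
    by unfold_locales
qed

text \<open>Words over the image alphabet lift letter by letter to words of the same length, and the
  projection commutes with evaluation and inverses.\<close>

lemma word_ball_quotient:
  assumes "N \<lhd> G"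
  shows "word_ball (G Mod N) ((\<lambda>s. N #> s) ` S \<union> m_inv (G Mod N) ` (\<lambda>s. N #> s) ` S) n =
    (\<lambda>x. N #> x) ` ball n"
proof -
  interpret \<pi>: group_hom G "G Mod N" "\<lambda>x. N #> x"
    using assms by (rule quotient_group_hom)
  have "m_inv (G Mod N) ` (\<lambda>s. N #> s) ` S = (\<lambda>s. N #> s) ` m_inv G ` S"
    unfolding image_image using S_closed by (intro image_cong refl) (use \<pi>.hom_inv in force)
  then have letters: "(\<lambda>s. N #> s) ` S \<union> m_inv (G Mod N) ` (\<lambda>s. N #> s) ` S = (\<lambda>s. N #> s) ` letters"
    by (simp add: image_Un)
  have words: "{vs. set vs \<subseteq> f ` A \<and> length vs \<le> n} = map f ` {ws. set ws \<subseteq> A \<and> length ws \<le> n}"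
    for f :: "'a \<Rightarrow> 'a set" and A
  proof (intro equalityI subsetI)
    fix vs assume vs: "vs \<in> {vs. set vs \<subseteq> f ` A \<and> length vs \<le> n}"
    then have "vs \<in> map f ` lists A"
      unfolding lists_image[symmetric] by auto
    then show "vs \<in> map f ` {ws. set ws \<subseteq> A \<and> length ws \<le> n}"
      using vs by auto
  next
    fix vs assume "vs \<in> map f ` {ws. set ws \<subseteq> A \<and> length ws \<le> n}"
    then show "vs \<in> {vs. set vs \<subseteq> f ` A \<and> length vs \<le> n}"
      using image_mono[of _ A f] by (elim imageE) simp
  qed
  have eval: "foldr (\<otimes>\<^bsub>G Mod N\<^esub>) (map (\<lambda>x. N #> x) ws) \<one>\<^bsub>G Mod N\<^esub> = N #> foldr (\<otimes>) ws \<one>"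
    if "set ws \<subseteq> carrier G" for ws
    using that
  proof (induction ws)
    case Nil
    then show ?case
      using \<pi>.hom_one by simp
  next
    case (Cons w ws)
    then show ?case
      using \<pi>.hom_mult[of w "foldr (\<otimes>) ws \<one>"] by simp
  qed
  show ?thesis
    unfolding letters unfolding word_ball_def words unfolding image_image
    by (rule image_cong[OF refl], rule eval) (use letters_closed in blast)
qed

text \<open>Injectivity fails only if \<open>M k\<close> contains one of the finitely many
  nontrivial elements \<open>x \<otimes> inv y\<close> with \<open>x\<close>, \<open>y\<close> in
  the ball. Each of them lies outside some member of the filtration, and as the sequence decreases,
  one index serves for all.\<close>

lemma ex_inj_on_ball:
  assumes "filtration G M"
  obtains k where "inj_on (\<lambda>x. M k #> x) (ball r)"
proof -
  have M: "M k \<lhd> G" "decseq M" "(\<Inter>k. M k) = {\<one>}" for k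
    using assms by (auto simp: filtration_def)
  define P where "P = (\<lambda>(x, y). x \<otimes> inv y) ` (ball r \<times> ball r) - {\<one>}"
  have finP: "finite P"
    by (simp add: P_def finite_ball)
  have "\<forall>z\<in>P. \<exists>k. z \<notin> M k"
    using M(3) by (auto simp: P_def)
  then obtain \<kappa> where \<kappa>: "\<And>z. z \<in> P \<Longrightarrow> z \<notin> M (\<kappa> z)"
    by metis
  define k where "k = Max (insert 0 (\<kappa> ` P))"
  have notin: "z \<notin> M k" if "z \<in> P" for z
  proof -
    have "\<kappa> z \<le> k"
      unfolding k_def using finP that by (intro Max_ge) auto
    then show ?thesis
      using \<kappa>[OF that] decseqD[OF M(2)] by blast
  qed
  have "inj_on (\<lambda>x. M k #> x) (ball r)"
  proof (rule inj_onI)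
    fix x y assume xy: "x \<in> ball r" "y \<in> ball r" and eq: "M k #> x = M k #> y"
    have c: "x \<in> carrier G" "y \<in> carrier G"
      using xy ball_closed by auto
    have sub: "subgroup (M k) G"
      using M(1) by (rule normal_imp_subgroup)
    have "x \<in> M k #> y"
      using eq rcos_self[OF c(1) sub] by simp
    then have "x \<otimes> inv y \<in> M k"
      by (rule subgroup.rcos_module_imp[OF sub is_group c(2)])
    then have "x \<otimes> inv y \<notin> P"
      using notin by blast
    then have "x \<otimes> inv y = \<one>"
      using xy by (auto simp: P_def)
    then show "x = y"
      using c by (metis inv_equality inv_inv inv_closed)
  qed
  then show thesis
    by (rule that)
qed

text \<open>The distance from \<open>x\<close> to \<open>y\<close> is the length of
  \<open>inv x \<otimes> y\<close>, and every length is a distance from \<open>\<one>\<close>; so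
  the diameter of a finite group is its largest word length.\<close>

lemma diam_word_metric:
  assumes "finite (carrier G)"
    and d: "\<And>x y. x \<in> carrier G \<Longrightarrow> y \<in> carrier G \<Longrightarrow> d (k, x) (k, y) = real (word_metric G S x y)"
  obtains x where "x \<in> carrier G" "diam d ({k} \<times> carrier G) = real (len x)"
    "\<And>y. y \<in> carrier G \<Longrightarrow> len y \<le> len x"
proof -
  define V where "V = (\<lambda>(p, q). d p q) ` (({k} \<times> carrier G) \<times> ({k} \<times> carrier G))"
  have V: "finite V" "V \<noteq> {}"
    using assms(1) one_closed by (auto simp: V_def)
  have diam: "diam d ({k} \<times> carrier G) = Max V"
    unfolding diam_def V_def[symmetric] using V by (rule cSup_eq_Max)
  have "Max V \<in> V"
    using V by (rule Max_in)
  then obtain x y where xy: "x \<in> carrier G" "y \<in> carrier G" "Max V = real (len (inv x \<otimes> y))"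
    unfolding V_def using d by (auto simp: word_metric_def)
  have "len z \<le> len (inv x \<otimes> y)" if "z \<in> carrier G" for z
  proof -
    have "real (len z) = d (k, \<one>) (k, z)"
      using d[OF one_closed that] that by (simp add: word_metric_def)
    then have "real (len z) \<in> V"
      using that one_closed unfolding V_def by (intro image_eqI[of _ _ "((k, \<one>), (k, z))"]) auto
    then have "real (len z) \<le> Max V"
      using V(1) by simp
    then show ?thesis
      using xy(3) by simp
  qed
  then show thesis
    using that[of "inv x \<otimes> y"] xy diam by simp
qed

end

section \<open>Property \<open>D\<close> for box spaces\<close>

theorem theorem3:
  fixes G :: "('a, 'b) monoid_scheme" and S :: "'a set" and M :: "nat \<Rightarrow> 'a set"
    and d :: "nat \<times> 'a set \<Rightarrow> nat \<times> 'a set \<Rightarrow> real"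
  assumes "group G"
    and "finite_generating_set G S"
    and "residually_finite G"
    and "filtration G M"
    and no_one_point_components: "\<And>k. M k \<noteq> carrier G"
    and "box_space_metric G S M d"
  shows "property_D G M d 1 \<longleftrightarrow> virtually_cyclic G"
proof -
  interpret finitely_generated_group G S
    using assms(1,2) by (intro finitely_generated_group.intro finitely_generated_group_axioms.intro)
  define T where "T k = (\<lambda>s. M k #>\<^bsub>G\<^esub> s) ` S" for k
  define B where "B k n = (\<lambda>x. M k #>\<^bsub>G\<^esub> x) ` ball n" for k n
  have normal: "M k \<lhd> G" and fin: "finite (carrier (G Mod M k))" for k
    using assms(4) by (auto simp: filtration_def finite_index_def FactGroup_def)
  have fg: "finitely_generated_group (G Mod M k) (T k)" for k
    unfolding T_def by (rule finitely_generated_quotient[OF normal])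
  have B: "word_ball (G Mod M k) (T k \<union> m_inv (G Mod M k) ` T k) n = B k n" for k n
    unfolding T_def B_def by (rule word_ball_quotient[OF normal])
  have card_component: "card (box_component G M k) = card (carrier (G Mod M k))" for k
    by (simp add: box_component_def card_cartesian_product_singleton)
  \<comment> \<open>For \<open>x\<close> of maximal length, the ball of radius its length is the
    whole quotient, so the quotient is covered by the image of a ball of \<open>G\<close>.\<close>
  have diam: "\<exists>x\<in>carrier (G Mod M k). diam d (box_component G M k) = real (word_length (G Mod M k) (T k) x) \<and>
    carrier (G Mod M k) \<subseteq> B k (word_length (G Mod M k) (T k) x)" for k
  proof -
    interpret Q: finitely_generated_group "G Mod M k" "T k"
      by (rule fg)
    have "d (k, x) (k, y) = real (word_metric (G Mod M k) (T k) x y)"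
      if "x \<in> carrier (G Mod M k)" "y \<in> carrier (G Mod M k)" for x y
      using assms(6) that by (simp add: box_space_metric_def T_def)
    from Q.diam_word_metric[OF fin this] obtain x
      where x: "x \<in> carrier (G Mod M k)" "diam d ({k} \<times> carrier (G Mod M k)) = real (Q.len x)"
        "\<And>y. y \<in> carrier (G Mod M k) \<Longrightarrow> Q.len y \<le> Q.len x"
      by metis
    then show ?thesis
      using Q.len_le_iff by (intro bexI[of _ x]) (auto simp: box_component_def simp flip: B)
  qed
  show ?thesis
  proof
    assume "property_D G M d 1"
    then obtain K where K: "0 < K"
      "\<And>k. K * real (card (carrier (G Mod M k))) \<le> diam d (box_component G M k)"
      by (auto simp: property_D_def card_component)
    \<comment> \<open>The index \<open>k\<close> depends on \<open>r\<close>, but \<open>K\<close>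
      does not. The constant comes from \<open>2 * r + 1 \<le> 2 * (r + 1)\<close>.\<close>
    have "real (card (ball r)) \<le> 2 / K * (real r + 1)" for r
    proof -
      obtain k where k: "inj_on (\<lambda>x. M k #>\<^bsub>G\<^esub> x) (ball r)"
        by (rule ex_inj_on_ball[OF assms(4)])
      obtain x where x: "x \<in> carrier (G Mod M k)"
        "diam d (box_component G M k) = real (word_length (G Mod M k) (T k) x)"
        using diam by blast
      define D where "D = word_length (G Mod M k) (T k) x"
      define m where "m = D div (2 * r + 1) + 1"
      have "m * card (B k r) \<le> card (carrier (G Mod M k))"
        using finitely_generated_group.packing[OF fg fin x(1), of r] by (simp add: m_def D_def B)
      then have "m * card (ball r) \<le> card (carrier (G Mod M k))"
        using k by (simp add: B_def card_image)
      then have "K * real (m * card (ball r)) \<le> K * real (card (carrier (G Mod M k)))"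
        using K(1) by (intro mult_left_mono of_nat_mono) simp_all
      also have "\<dots> \<le> real D"
        using K(2)[of k] x(2) by (simp add: D_def)
      \<comment> \<open>The number \<open>m\<close> of disjoint balls was rounded so that
        \<open>m\<close> spacings cover \<open>D\<close>; it then cancels from both sides.\<close>
      also have "\<dots> \<le> real ((2 * r + 1) * m)"
      proof (rule of_nat_mono)
        have "D = (2 * r + 1) * (D div (2 * r + 1)) + D mod (2 * r + 1)"
          by (rule mult_div_mod_eq[symmetric])
        also have "\<dots> \<le> (2 * r + 1) * (D div (2 * r + 1)) + (2 * r + 1)"
          by (intro add_left_mono) (simp add: less_imp_le)
        finally show "D \<le> (2 * r + 1) * m"
          by (simp add: m_def algebra_simps)
      qed
      finally have "(K * real (card (ball r))) * real m \<le> real (2 * r + 1) * real m"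
        by (simp add: algebra_simps)
      then have "K * real (card (ball r)) \<le> real (2 * r + 1)"
        by (rule mult_right_le_imp_le) (simp add: m_def)
      then show ?thesis
        using K(1) by (simp add: field_simps)
    qed
    then have "linear_growth"
      unfolding linear_growth_def by blast
    then show "virtually_cyclic G"
      by (rule linear_growth_imp_virtually_cyclic)
  next
    assume "virtually_cyclic G"
    then obtain c where c: "\<And>n. real (card (ball n)) \<le> c * (real n + 1)"
      using virtually_cyclic_imp_linear_growth by (auto simp: linear_growth_def)
    have "0 < card (ball 0)"
      using one_in_ball finite_ball by (auto simp: card_gt_0_iff)
    then have "0 < c"
      using c[of 0] by simp
    have "1 / (2 * c) * real (card (carrier (G Mod M k))) \<le> diam d (box_component G M k)" for k
    proof -
      obtain D where D: "diam d (box_component G M k) = real D" "carrier (G Mod M k) \<subseteq> B k D"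
        using diam by blast
      \<comment> \<open>Diameter 0 would force a one-point component, excluded by
        \<open>no_one_point_components\<close>. With \<open>D \<ge> 1\<close>, the bound
        \<open>c * (D + 1)\<close> is at most \<open>2 * c * D\<close>, whence the constant
        \<open>1 / (2 * c)\<close>.\<close>
      have "D \<noteq> 0"
      proof
        assume "D = 0"
        then have "carrier (G Mod M k) \<subseteq> {M k #>\<^bsub>G\<^esub> \<one>\<^bsub>G\<^esub>}"
          using D(2) by (auto simp: B_def word_ball_def)
        then have "M k #>\<^bsub>G\<^esub> x = M k" if "x \<in> carrier G" for x
          using that normal_imp_subgroup[OF normal[of k]]
          by (auto simp: carrier_FactGroup subgroup.subset)
        then have "carrier G \<subseteq> M k"
          using coset_join1[OF _ _ normal_imp_subgroup[OF normal]] by blast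
        then show False
          using no_one_point_components[of k] subgroup.subset[OF normal_imp_subgroup[OF normal[of k]]]
          by blast
      qed
      have "card (carrier (G Mod M k)) \<le> card (B k D)"
        using D(2) by (intro card_mono) (simp_all add: B_def finite_ball)
      also have "\<dots> \<le> card (ball D)"
        unfolding B_def by (rule card_image_le[OF finite_ball])
      finally have "real (card (carrier (G Mod M k))) \<le> c * (real D + 1)"
        using c[of D] by simp
      also have "\<dots> \<le> c * (2 * real D)"
        using \<open>0 < c\<close> \<open>D \<noteq> 0\<close> by (intro mult_left_mono) auto
      finally show ?thesis
        using \<open>0 < c\<close> D(1) by (simp add: field_simps)
    qed
    then show "property_D G M d 1"
      unfolding property_D_def card_component using \<open>0 < c\<close>
      by (intro exI[of _ "1 / (2 * c)"]) simp
  qed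
qed

end
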